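(* Let $R = k[x_1,\ldots,x_n]$ be a polynomial ring over a field $k$. If $Q$ is a monomial primary ideal of $R$ and $Q=\bigcap_{i=1}^{r}Q_i$ is its standard decomposition, then $$\omega(Q)=\omega^{\bullet}(Q)=\max_{1\le i\le r}\{e(Q_i)\}.$$
   Context: $\mathbb{N}=\{1,2,\ldots\}$. For $N\in\mathbb{N}$, an ideal $I$ of a commutative ring $R$ with unity is $N$-absorbing if whenever $f_1,\ldots,f_{N+1}\in R$ satisfy $f_1\cdots f_{N+1}\in I$, there is some $j$ such that the product of the $f_i$ with $i\ne j$ lies in $I$. $I$ is strongly $N$-absorbing if whenever ideals $I_1,\ldots,I_{N+1}$ of $R$ satisfy $I_1\cdots I_{N+1}\subseteq I$, there is some $j$ such that the product of the $I_i$ with $i\neq j$ is contained in $I$. $\omega(I)$ (resp. $\omega^{\bullet}(I)$) is the least $N\in\mathbb{N}$ for which $I$ is $N$-absorbing (resp. strongly $N$-absorbing), or $\infty$ if there is none; by convention $\omega(R)=\omega^{\bullet}(R)=0$. The Noether exponent $e(I)$ is the least $\mu\in\mathbb{N}$ with $(\sqrt{I})^{\mu}\subseteq I$ ($\infty$ if none), with $e(R)=0$. A monomial ideal of $k[x_1,\ldots,x_n]$ is an ideal generated by monomials. Every (proper) monomial ideal can be written as a finite intersection of ideals of the form $(x_{i_1}^{d_1},\ldots,x_{i_m}^{d_m})$ with $d_j\in\mathbb{N}$, and an irredundant presentation of this form (no member can be omitted) is unique; it is called the standard decomposition of the ideal. *)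

theory Defs
  imports Complex_Main "HOL-Library.Extended_Nat" "HOL-Library.Poly_Mapping"
begin

text \<open>Ideals are the submodules of the ring acting on itself by multiplication.\<close>

lemma module_mult: "module ((*) :: 'a::comm_ring_1 \<Rightarrow> 'a \<Rightarrow> 'a)"
  by (simp add: module_def algebra_simps)

definition is_ideal :: "'a::comm_ring_1 set \<Rightarrow> bool" where
  "is_ideal I \<longleftrightarrow> module.subspace (*) I"

definition ideal_gen :: "'a::comm_ring_1 set \<Rightarrow> 'a set" where
  "ideal_gen S = module.span (*) S"

lemma is_ideal_iff:
  "is_ideal I \<longleftrightarrow> 0 \<in> I \<and> (\<forall>x\<in>I. \<forall>y\<in>I. x + y \<in> I) \<and> (\<forall>c. \<forall>x\<in>I. c * x \<in> I)"
  by (simp add: is_ideal_def module.subspace_def[OF module_mult])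

lemma is_ideal_gen: "is_ideal (ideal_gen S)"
  by (simp add: is_ideal_def ideal_gen_def module.subspace_span[OF module_mult])

text \<open>Product of a finite family of ideals; the empty product is the whole ring.\<close>

definition ideal_prod :: "'i set \<Rightarrow> ('i \<Rightarrow> 'a::comm_ring_1 set) \<Rightarrow> 'a set" where
  "ideal_prod A J = ideal_gen {(\<Prod>i\<in>A. f i) | f. \<forall>i\<in>A. f i \<in> J i}"

definition ideal_power :: "'a::comm_ring_1 set \<Rightarrow> nat \<Rightarrow> 'a set" where
  "ideal_power I m = ideal_prod {1..m} (\<lambda>_. I)"

definition radical :: "'a::comm_ring_1 set \<Rightarrow> 'a set" where
  "radical I = {f. \<exists>m\<ge>1. f ^ m \<in> I}"

definition primary_ideal :: "'a::comm_ring_1 set \<Rightarrow> bool" where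
  "primary_ideal I \<longleftrightarrow> is_ideal I \<and> I \<noteq> UNIV \<and>
     (\<forall>f g. f * g \<in> I \<longrightarrow> f \<in> I \<or> g \<in> radical I)"

definition absorbing :: "nat \<Rightarrow> 'a::comm_ring_1 set \<Rightarrow> bool" where
  "absorbing N I \<longleftrightarrow>
     (\<forall>f :: nat \<Rightarrow> 'a. (\<Prod>i\<in>{1..N+1}. f i) \<in> I \<longrightarrow>
        (\<exists>j\<in>{1..N+1}. (\<Prod>i\<in>{1..N+1} - {j}. f i) \<in> I))"

definition strongly_absorbing :: "nat \<Rightarrow> 'a::comm_ring_1 set \<Rightarrow> bool" where
  "strongly_absorbing N I \<longleftrightarrow>
     (\<forall>J :: nat \<Rightarrow> 'a set. (\<forall>i\<in>{1..N+1}. is_ideal (J i)) \<longrightarrow>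
        ideal_prod {1..N+1} J \<subseteq> I \<longrightarrow>
        (\<exists>j\<in>{1..N+1}. ideal_prod ({1..N+1} - {j}) J \<subseteq> I))"

text \<open>In \<^typ>\<open>enat\<close>, the infimum of the empty set is \<open>\<infinity>\<close> and the infimum of a nonempty set is
  its least element.\<close>

definition omega :: "'a::comm_ring_1 set \<Rightarrow> enat" where
  "omega I = (if I = UNIV then 0 else Inf (enat ` {N. N \<ge> 1 \<and> absorbing N I}))"

definition strong_omega :: "'a::comm_ring_1 set \<Rightarrow> enat" where
  "strong_omega I = (if I = UNIV then 0 else Inf (enat ` {N. N \<ge> 1 \<and> strongly_absorbing N I}))"

definition noether_exponent :: "'a::comm_ring_1 set \<Rightarrow> enat" where
  "noether_exponent I =
     (if I = UNIV then 0 else Inf (enat ` {m. m \<ge> 1 \<and> ideal_power (radical I) m \<subseteq> I}))"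

text \<open>The polynomial ring over \<^typ>\<open>'k\<close> in finitely many variables indexed by a finite type \<^typ>\<open>'n\<close>:
  an exponent vector is a map from variables to naturals, a polynomial is a finitely supported map
  from exponent vectors to coefficients, and multiplication is convolution.\<close>

type_synonym ('n, 'k) mpoly = "('n \<Rightarrow>\<^sub>0 nat) \<Rightarrow>\<^sub>0 'k"

definition monomials :: "('n, 'k::field) mpoly set" where
  "monomials = range (\<lambda>a. Poly_Mapping.single a 1)"

definition var :: "'n \<Rightarrow> ('n, 'k::field) mpoly" where
  "var i = Poly_Mapping.single (Poly_Mapping.single i 1) 1"

definition monomial_ideal :: "('n, 'k::field) mpoly set \<Rightarrow> bool" where
  "monomial_ideal I \<longleftrightarrow> (\<exists>S \<subseteq> monomials. I = ideal_gen S)"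

text \<open>Ideals generated by powers, with positive exponents, of some of the variables. The set of
  variables may be empty, as is needed for decomposing the zero ideal.\<close>

definition pure_power_ideal :: "('n, 'k::field) mpoly set \<Rightarrow> bool" where
  "pure_power_ideal I \<longleftrightarrow>
     (\<exists>A d. (\<forall>i\<in>A. d i \<ge> (1::nat)) \<and> I = ideal_gen ((\<lambda>i. var i ^ d i) ` A))"

text \<open>For \<open>r = 1\<close> irredundancy amounts to \<open>Q \<noteq> UNIV\<close>, the empty intersection being the whole
  ring.\<close>

definition standard_decomposition ::
    "('n, 'k::field) mpoly set \<Rightarrow> nat \<Rightarrow> (nat \<Rightarrow> ('n, 'k) mpoly set) \<Rightarrow> bool" where
  "standard_decomposition Q r Qs \<longleftrightarrow>
     (\<forall>i\<in>{1..r}. pure_power_ideal (Qs i)) \<and>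
     Q = (\<Inter>i\<in>{1..r}. Qs i) \<and>
     (\<forall>j\<in>{1..r}. (\<Inter>i\<in>{1..r} - {j}. Qs i) \<noteq> Q)"

end

theory Submission
  imports Defs
begin

text \<open>
  Write \<open>P\<close> for the radical of \<open>Q\<close> and \<open>e\<close> for the largest Noether exponent of a component. The proof
  closes the chain \<open>omega Q \<le> strong_omega Q \<le> e \<le> omega Q\<close>; the first inequality is the remark that
  the absorbing property is the strong one restricted to principal ideals.

  The second inequality is ideal theory. In an irredundant decomposition of a primary ideal every
  component has radical \<open>P\<close> (\<open>radical_component_of_primary\<close>), so \<open>P\<close> to the power \<open>e\<close> lies in all
  components and hence in \<open>Q\<close>. If a product of \<open>e + 1\<close> ideals lies in \<open>Q\<close>, then either one of them is
  not contained in \<open>P\<close> and can be cancelled because \<open>Q\<close> is primary, or all of them are contained in \<open>P\<close>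
  and any \<open>e\<close> of them already have their product in \<open>Q\<close> (\<open>primary_strongly_absorbing\<close>).

  The third inequality uses monomials. As the components share their radical, each of them is
  generated by powers of the same variables \<open>x\<^sub>j\<close>, \<open>j \<in> A\<close>. Fix one component, with exponents \<open>d\<^sub>j\<close>,
  and let \<open>m\<close> be the product of the \<open>x\<^sub>j\<close> to the power \<open>d\<^sub>j - 1\<close>, the largest monomial in these variables
  outside this component. By irredundancy some monomial lies in all other components but not in this
  one. Its part in the variables \<open>x\<^sub>j\<close> divides \<open>m\<close>, so \<open>m\<close> also lies in all other components, and
  \<open>x\<^sub>j m \<in> Q\<close> for every \<open>j \<in> A\<close>. Consider the factors of \<open>m\<close>, a list of \<open>deg m\<close> variables,
  together with the linear form \<open>L\<close>, the sum of the \<open>x\<^sub>j\<close>. The product of all these is in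
  \<open>Q\<close>. Leaving out \<open>L\<close> gives \<open>m\<close>, and leaving out one \<open>x\<^sub>l\<close> gives a polynomial in which the monomial \<open>m\<close> has coefficient 1; neither is in
  \<open>Q\<close> (\<open>socle_monomial_not_absorbing\<close>). So \<open>Q\<close> is not \<open>N\<close>-absorbing for \<open>N = deg m\<close>,
  nor for smaller \<open>N\<close> (\<open>absorbing_mono\<close>), whereas for
  \<open>N > deg m\<close> counting degrees shows that \<open>P\<close> to the power \<open>N\<close> is contained in the component
  (\<open>ideal_power_radical_subset\<close>). The count needs that every term of an element of \<open>P\<close> involves some
  \<open>x\<^sub>j\<close> with \<open>j \<in> A\<close>; this is \<open>degree_in_pos_of_power\<close>.
\<close>

section \<open>Products of ideals and absorbing ideals\<close>

lemma ideal_gen_subset_iff: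
  assumes "is_ideal I"
  shows "ideal_gen S \<subseteq> I \<longleftrightarrow> S \<subseteq> I"
  using assms module.span_minimal[OF module_mult] module.span_superset[OF module_mult]
  unfolding is_ideal_def ideal_gen_def by blast

lemma ideal_prod_subset_iff:
  assumes "is_ideal I"
  shows "ideal_prod A J \<subseteq> I \<longleftrightarrow> (\<forall>f. (\<forall>i\<in>A. f i \<in> J i) \<longrightarrow> (\<Prod>i\<in>A. f i) \<in> I)"
  unfolding ideal_prod_def ideal_gen_subset_iff[OF assms] by blast

lemma ideal_mult_left: "is_ideal I \<Longrightarrow> x \<in> I \<Longrightarrow> c * x \<in> I"
  and ideal_mult_right: "is_ideal I \<Longrightarrow> x \<in> I \<Longrightarrow> x * c \<in> I"
  and ideal_zero: "is_ideal I \<Longrightarrow> 0 \<in> I"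
  and ideal_add: "is_ideal I \<Longrightarrow> x \<in> I \<Longrightarrow> y \<in> I \<Longrightarrow> x + y \<in> I"
  by (auto simp: is_ideal_iff mult.commute[of x])

lemma ideal_sum:
  assumes "is_ideal I" "\<And>i. i \<in> A \<Longrightarrow> f i \<in> I"
  shows "(\<Sum>i\<in>A. f i) \<in> I"
  using assms(2)
  by (induction A rule: infinite_finite_induct) (auto simp: ideal_zero[OF assms(1)] ideal_add[OF assms(1)])

lemma ideal_power_subset_mono:
  assumes I: "is_ideal I" and "m \<le> n" and sub: "ideal_power J m \<subseteq> I"
  shows "ideal_power J n \<subseteq> I"
  unfolding ideal_power_def ideal_prod_subset_iff[OF I]
proof (intro allI impI)
  fix f assume f: "\<forall>i\<in>{1..n}. f i \<in> J"
  have "{1..n} = {1..m} \<union> {m+1..n}" using \<open>m \<le> n\<close> by auto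
  then have "(\<Prod>i\<in>{1..n}. f i) = (\<Prod>i\<in>{1..m}. f i) * (\<Prod>i\<in>{m+1..n}. f i)"
    by (simp add: prod.union_disjoint)
  moreover have "(\<Prod>i\<in>{1..m}. f i) \<in> I"
    using sub f \<open>m \<le> n\<close> unfolding ideal_power_def ideal_prod_subset_iff[OF I] by auto
  ultimately show "(\<Prod>i\<in>{1..n}. f i) \<in> I"
    by (simp add: ideal_mult_right[OF I])
qed

lemma Inf_enat_image_le_iff:
  "Inf (enat ` {N. P N}) \<le> enat n \<longleftrightarrow> (\<exists>N\<le>n. P N)"
proof
  assume le: "Inf (enat ` {N. P N}) \<le> enat n"
  have "enat ` {N. P N} \<noteq> {}"
  proof
    assume "enat ` {N. P N} = {}"
    then have "Inf (enat ` {N. P N}) = \<infinity>" by (simp only: Inf_empty top_enat_def)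
    with le show False by simp
  qed
  then have "Inf (enat ` {N. P N}) \<in> enat ` {N. P N}"
    unfolding Inf_enat_def by (auto intro: LeastI)
  with le show "\<exists>N\<le>n. P N" by auto
next
  assume "\<exists>N\<le>n. P N"
  then obtain N where "N \<le> n" "P N" by blast
  then have "Inf (enat ` {N. P N}) \<le> enat N" by (intro Inf_lower) auto
  also have "\<dots> \<le> enat n" using \<open>N \<le> n\<close> by simp
  finally show "Inf (enat ` {N. P N}) \<le> enat n" .
qed

lemma noether_exponent_le_imp:
  assumes I: "is_ideal I" and le: "noether_exponent I \<le> enat N"
  shows "ideal_power (radical I) N \<subseteq> I"
proof (cases "I = UNIV")
  case False
  then have "\<exists>m\<le>N. m \<ge> 1 \<and> ideal_power (radical I) m \<subseteq> I"
    using le by (simp add: noether_exponent_def Inf_enat_image_le_iff)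
  then show ?thesis using ideal_power_subset_mono[OF I] by blast
qed simp

lemma noether_exponent_leI:
  assumes "1 \<le> N" "ideal_power (radical I) N \<subseteq> I"
  shows "noether_exponent I \<le> enat N"
proof (cases "I = UNIV")
  case False
  have "\<exists>m\<le>N. m \<ge> 1 \<and> ideal_power (radical I) m \<subseteq> I" using assms by blast
  then show ?thesis using False by (simp add: noether_exponent_def Inf_enat_image_le_iff)
qed (simp add: noether_exponent_def)

lemma noether_exponent_0_iff: "noether_exponent I = 0 \<longleftrightarrow> I = UNIV"
  using Inf_enat_image_le_iff[of "\<lambda>m. m \<ge> 1 \<and> ideal_power (radical I) m \<subseteq> I" 0]
  by (auto simp: noether_exponent_def zero_enat_def)

lemma strongly_absorbing_imp_absorbing:
  assumes I: "is_ideal I" and "strongly_absorbing N I"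
  shows "absorbing N I"
  unfolding absorbing_def
proof (intro allI impI)
  fix f :: "nat \<Rightarrow> 'a" assume f: "(\<Prod>i\<in>{1..N+1}. f i) \<in> I"
  define J where "J i = range (\<lambda>c. c * f i)" for i
  have J: "is_ideal (J i)" for i
    unfolding is_ideal_iff
  proof (intro conjI ballI allI)
    show "0 \<in> J i" unfolding J_def by (rule image_eqI[of _ _ 0]) auto
    show "x + y \<in> J i" if "x \<in> J i" "y \<in> J i" for x y
      using that unfolding J_def by (auto simp flip: distrib_right)
    show "c * x \<in> J i" if "x \<in> J i" for c x
      using that unfolding J_def by (auto simp flip: mult.assoc)
  qed
  have "ideal_prod {1..N+1} J \<subseteq> I"
    unfolding ideal_prod_subset_iff[OF I]
  proof (intro allI impI)
    fix g assume "\<forall>i\<in>{1..N+1}. g i \<in> J i"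
    then have "\<forall>i\<in>{1..N+1}. \<exists>c. g i = c * f i" unfolding J_def by blast
    then obtain c where "\<forall>i\<in>{1..N+1}. g i = c i * f i" by metis
    then have "(\<Prod>i\<in>{1..N+1}. g i) = (\<Prod>i\<in>{1..N+1}. c i) * (\<Prod>i\<in>{1..N+1}. f i)"
      by (simp add: prod.distrib del: prod.cl_ivl_Suc)
    then show "(\<Prod>i\<in>{1..N+1}. g i) \<in> I" using f ideal_mult_left[OF I] by simp
  qed
  then obtain j where j: "j \<in> {1..N+1}" "ideal_prod ({1..N+1} - {j}) J \<subseteq> I"
    using assms(2) J unfolding strongly_absorbing_def by blast
  have "f i \<in> J i" for i unfolding J_def by (rule image_eqI[of _ _ 1]) auto
  with j show "\<exists>j\<in>{1..N+1}. (\<Prod>i\<in>{1..N+1} - {j}. f i) \<in> I"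
    unfolding ideal_prod_subset_iff[OF I] by blast
qed

lemma omega_le_strong_omega:
  assumes "is_ideal I"
  shows "omega I \<le> strong_omega I"
  unfolding omega_def strong_omega_def
  using strongly_absorbing_imp_absorbing[OF assms] by (auto intro!: Inf_superset_mono image_mono)

text \<open>The last two of the \<open>N + 2\<close> factors are merged into one. If the merged factor is the one that can
  be left out, then so can either of its two parts.\<close>

lemma absorbing_Suc:
  assumes I: "is_ideal I" and abs: "absorbing N I"
  shows "absorbing (Suc N) I"
  unfolding absorbing_def
proof (intro allI impI)
  fix f :: "nat \<Rightarrow> 'a" assume f: "(\<Prod>i\<in>{1..Suc N+1}. f i) \<in> I"
  define g where "g = f(N+1 := f (N+1) * f (N+2))"
  have S: "{1..N+1} = insert (N+1) {1..N}" "{1..Suc N+1} = insert (N+2) (insert (N+1) {1..N})"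
    by auto
  have gprod: "(\<Prod>i\<in>B. g i) = (\<Prod>i\<in>B. f i)" if "B \<subseteq> {1..N}" for B
    by (rule prod.cong) (use that in \<open>auto simp: g_def\<close>)
  have "(\<Prod>i\<in>{1..N+1}. g i) = (\<Prod>i\<in>{1..Suc N+1}. f i)"
    unfolding S by (simp add: gprod) (simp add: g_def mult_ac)
  then obtain j where j: "j \<in> {1..N+1}" and gj: "(\<Prod>i\<in>{1..N+1} - {j}. g i) \<in> I"
    using abs f unfolding absorbing_def by metis
  show "\<exists>j\<in>{1..Suc N+1}. (\<Prod>i\<in>{1..Suc N+1} - {j}. f i) \<in> I"
  proof (cases "j = N+1")
    case True
    then have "{1..N+1} - {j} = {1..N}" by auto
    then have "(\<Prod>i\<in>{1..N}. f i) \<in> I" using gj gprod[of "{1..N}"] by simp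
    moreover have "{1..Suc N+1} - {N+2} = insert (N+1) {1..N}" by auto
    ultimately have "(\<Prod>i\<in>{1..Suc N+1} - {N+2}. f i) \<in> I" using ideal_mult_left[OF I] by simp
    then show ?thesis by (intro bexI[of _ "N+2"]) auto
  next
    case False
    then have eqs: "{1..N+1} - {j} = insert (N+1) ({1..N} - {j})"
      "{1..Suc N+1} - {j} = insert (N+2) (insert (N+1) ({1..N} - {j}))" using j by auto
    have "(\<Prod>i\<in>{1..Suc N+1} - {j}. f i) = (\<Prod>i\<in>{1..N+1} - {j}. g i)"
      unfolding eqs by (simp add: gprod) (simp add: g_def mult_ac)
    then show ?thesis using gj j by (intro bexI[of _ j]) auto
  qed
qed

lemma absorbing_mono:
  assumes "is_ideal I" "N \<le> M" "absorbing N I"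
  shows "absorbing M I"
  using assms(2,3) by (induction M rule: dec_induct) (auto intro: absorbing_Suc[OF assms(1)])

section \<open>Primary ideals and irredundant intersections\<close>

text \<open>A factor outside the radical can be cancelled, since \<open>Q\<close> is primary. If there is none, the product
  of any \<open>N\<close> factors is in the \<open>N\<close>-th power of the radical.\<close>

lemma primary_strongly_absorbing:
  assumes Q: "primary_ideal Q" and pow: "ideal_power (radical Q) N \<subseteq> Q"
  shows "strongly_absorbing N Q"
  unfolding strongly_absorbing_def
proof (intro allI impI)
  fix J :: "nat \<Rightarrow> 'a set"
  assume sub: "ideal_prod {1..N+1} J \<subseteq> Q"
  have I: "is_ideal Q" and prim: "\<And>f g. f * g \<in> Q \<Longrightarrow> f \<in> Q \<or> g \<in> radical Q"
    using Q unfolding primary_ideal_def by auto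
  show "\<exists>j\<in>{1..N+1}. ideal_prod ({1..N+1} - {j}) J \<subseteq> Q"
  proof (cases "\<exists>j\<in>{1..N+1}. \<not> J j \<subseteq> radical Q")
    case True
    then obtain j g where j: "j \<in> {1..N+1}" and g: "g \<in> J j" "g \<notin> radical Q" by blast
    have "ideal_prod ({1..N+1} - {j}) J \<subseteq> Q"
      unfolding ideal_prod_subset_iff[OF I]
    proof (intro allI impI)
      fix f assume f: "\<forall>i\<in>{1..N+1} - {j}. f i \<in> J i"
      let ?h = "f(j := g)"
      have "\<forall>i\<in>{1..N+1}. ?h i \<in> J i" using f g by auto
      then have "(\<Prod>i\<in>{1..N+1}. ?h i) \<in> Q"
        using sub unfolding ideal_prod_subset_iff[OF I] by blast
      moreover have "(\<Prod>i\<in>{1..N+1}. ?h i) = ?h j * (\<Prod>i\<in>{1..N+1} - {j}. ?h i)"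
        using j by (intro prod.remove) auto
      moreover have "(\<Prod>i\<in>{1..N+1} - {j}. ?h i) = (\<Prod>i\<in>{1..N+1} - {j}. f i)"
        by (intro prod.cong) auto
      ultimately have "(\<Prod>i\<in>{1..N+1} - {j}. f i) * g \<in> Q" by (simp add: mult.commute)
      with prim g(2) show "(\<Prod>i\<in>{1..N+1} - {j}. f i) \<in> Q" by blast
    qed
    with j show ?thesis by blast
  next
    case False
    have eq: "{1..N+1} - {N+1} = {1..N}" by auto
    have "ideal_prod ({1..N+1} - {N+1}) J \<subseteq> Q"
      unfolding eq ideal_prod_subset_iff[OF I]
      using pow False unfolding ideal_power_def ideal_prod_subset_iff[OF I] by fastforce
    then show ?thesis by (intro bexI[of _ "N+1"]) auto
  qed
qed

text \<open>Here \<open>I\<close> is one component of a decomposition and \<open>K\<close> the intersection of the others. An element \<open>u\<close>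
  of \<open>K\<close> outside \<open>Q\<close>, which irredundancy provides, multiplies \<open>I\<close> into \<open>Q\<close>, and then \<open>Q\<close> being primary
  puts \<open>I\<close> into the radical of \<open>Q\<close>.\<close>

lemma radical_component_of_primary:
  assumes Q: "primary_ideal Q" and QI: "Q = I \<inter> K" and I: "is_ideal I" and K: "is_ideal K"
    and irr: "K \<noteq> Q"
  shows "radical I = radical Q"
proof
  show "radical Q \<subseteq> radical I" using QI unfolding radical_def by blast
  show "radical I \<subseteq> radical Q"
  proof
    fix f assume "f \<in> radical I"
    then obtain m where m: "m \<ge> 1" "f ^ m \<in> I" unfolding radical_def by blast
    obtain u where u: "u \<in> K" "u \<notin> Q" using irr QI by blast
    have "u * f ^ m \<in> Q"
      using m u ideal_mult_left[OF I] ideal_mult_right[OF K] QI by blast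
    then have "f ^ m \<in> radical Q" using Q u(2) unfolding primary_ideal_def by blast
    then obtain l where "l \<ge> 1" "(f ^ m) ^ l \<in> Q" unfolding radical_def by blast
    then show "f \<in> radical Q" using m(1) unfolding radical_def
      by (auto simp flip: power_mult intro!: exI[of _ "m * l"])
  qed
qed

section \<open>Polynomials and their exponent vectors\<close>

definition degree_in :: "'n set \<Rightarrow> ('n::finite \<Rightarrow>\<^sub>0 nat) \<Rightarrow> nat" where
  "degree_in A a = (\<Sum>j\<in>A. Poly_Mapping.lookup a j)"

lemma degree_in_add: "degree_in A (a + b) = degree_in A a + degree_in A b"
  by (simp add: degree_in_def lookup_add sum.distrib)

lemma degree_in_zero [simp]: "degree_in A 0 = 0"
  by (simp add: degree_in_def)

lemma degree_in_ge_iff_1: "1 \<le> degree_in A a \<longleftrightarrow> (\<exists>j\<in>A. 1 \<le> Poly_Mapping.lookup a j)"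
proof -
  have ge: "1 \<le> n \<longleftrightarrow> n \<noteq> 0" for n :: nat by auto
  show ?thesis unfolding ge by (simp add: degree_in_def)
qed

lemma card_le_degree_in_prod:
  fixes f :: "'i \<Rightarrow> ('n::finite, 'k::field) mpoly"
  assumes "finite S" "\<And>i a. i \<in> S \<Longrightarrow> a \<in> Poly_Mapping.keys (f i) \<Longrightarrow> 1 \<le> degree_in A a" "a \<in> Poly_Mapping.keys (\<Prod>i\<in>S. f i)"
  shows "card S \<le> degree_in A a"
  using assms
proof (induction S arbitrary: a rule: finite_induct)
  case (insert x S)
  then obtain b c where bc: "b \<in> Poly_Mapping.keys (f x)" "c \<in> Poly_Mapping.keys (\<Prod>i\<in>S. f i)" "a = b + c"
    using keys_mult[of "f x" "\<Prod>i\<in>S. f i"] by auto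
  have "1 \<le> degree_in A b" "card S \<le> degree_in A c" using insert bc by auto
  then show ?case using insert bc by (simp add: degree_in_add)
qed simp

lemma var_power:
  "(var i :: ('n, 'k::field) mpoly) ^ d = Poly_Mapping.single (Poly_Mapping.single i d) 1"
proof (induction d)
  case (Suc d)
  have "(var i :: ('n, 'k) mpoly) ^ Suc d = Poly_Mapping.single (Poly_Mapping.single i 1 + Poly_Mapping.single i d) 1"
    unfolding power_Suc Suc.IH by (simp only: var_def mult_single mult_1)
  then show ?case by (simp only: single_add[symmetric] plus_1_eq_Suc)
qed simp

lemma poly_mapping_eq_sum_single:
  "(p :: 'a \<Rightarrow>\<^sub>0 'b::comm_monoid_add) =
     (\<Sum>a\<in>Poly_Mapping.keys p. Poly_Mapping.single a (Poly_Mapping.lookup p a))"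
proof (rule poly_mapping_eqI)
  fix k
  show "Poly_Mapping.lookup p k =
      Poly_Mapping.lookup (\<Sum>a\<in>Poly_Mapping.keys p. Poly_Mapping.single a (Poly_Mapping.lookup p a)) k"
    unfolding lookup_sum lookup_single when_def by (simp add: in_keys_iff)
qed

text \<open>If an exponent vector is in only one way a sum of exponents of \<open>f\<close> and \<open>g\<close>, no cancellation can
  occur there in \<open>f * g\<close>.\<close>

lemma lookup_mult_unique:
  fixes f g :: "('n, 'k::field) mpoly"
  assumes uniq: "\<And>b c. b \<in> Poly_Mapping.keys f \<Longrightarrow> c \<in> Poly_Mapping.keys g \<Longrightarrow> b + c = a + a' \<Longrightarrow> b = a \<and> c = a'"
  shows "Poly_Mapping.lookup (f * g) (a + a') = Poly_Mapping.lookup f a * Poly_Mapping.lookup g a'"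
proof -
  define f' where "f' = f - Poly_Mapping.single a (Poly_Mapping.lookup f a)"
  define g' where "g' = g - Poly_Mapping.single a' (Poly_Mapping.lookup g a')"
  have kf: "Poly_Mapping.keys f' \<subseteq> Poly_Mapping.keys f - {a}" and kg: "Poly_Mapping.keys g' \<subseteq> Poly_Mapping.keys g - {a'}"
    by (auto simp: f'_def g'_def in_keys_iff lookup_minus lookup_single when_def split: if_splits)
  have split: "f * g = f' * g + Poly_Mapping.single a (Poly_Mapping.lookup f a) * g'
      + Poly_Mapping.single (a + a') (Poly_Mapping.lookup f a * Poly_Mapping.lookup g a')"
    by (simp add: f'_def g'_def algebra_simps flip: mult_single)
  have "a + a' \<notin> Poly_Mapping.keys (f' * g)"
  proof
    assume "a + a' \<in> Poly_Mapping.keys (f' * g)"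
    then obtain b c where bc: "b \<in> Poly_Mapping.keys f'" "c \<in> Poly_Mapping.keys g" "a + a' = b + c"
      using keys_mult[of f' g] by blast
    then show False using kf uniq[of b c] by auto
  qed
  moreover have "a + a' \<notin> Poly_Mapping.keys (Poly_Mapping.single a (Poly_Mapping.lookup f a) * g')"
  proof
    assume "a + a' \<in> Poly_Mapping.keys (Poly_Mapping.single a (Poly_Mapping.lookup f a) * g')"
    then obtain b c where bc: "b \<in> Poly_Mapping.keys (Poly_Mapping.single a (Poly_Mapping.lookup f a))" "c \<in> Poly_Mapping.keys g'" "a + a' = b + c"
      using keys_mult by blast
    then have "b = a" "Poly_Mapping.lookup f a \<noteq> 0" by (auto split: if_splits)
    then show False using bc uniq[of b c] kg by (auto simp: in_keys_iff)
  qed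
  ultimately show ?thesis by (simp add: split lookup_add in_keys_iff)
qed

text \<open>The next results show that the ideal generated by the variables in \<open>A\<close> is radical. They do so
  without ordering the exponent vectors: among the exponents of \<open>f\<close> that avoid \<open>A\<close>, let \<open>a\<close> be one of
  greatest Euclidean length. It is a vertex of their convex hull, and the linear functional given by
  the dot product with \<open>a\<close> takes its maximum only there. Hence \<open>m\<close> times \<open>a\<close> arises in just one way
  as a sum of \<open>m\<close> exponents of \<open>f\<close>, and it is an exponent of the \<open>m\<close>-th power of \<open>f\<close>.\<close>

definition dotprod :: "('n::finite \<Rightarrow>\<^sub>0 nat) \<Rightarrow> ('n \<Rightarrow>\<^sub>0 nat) \<Rightarrow> nat" where
  "dotprod a b = (\<Sum>j\<in>UNIV. Poly_Mapping.lookup a j * Poly_Mapping.lookup b j)"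

lemma dotprod_add: "dotprod a (b + c) = dotprod a b + dotprod a c"
  by (simp add: dotprod_def lookup_add sum.distrib algebra_simps)

text \<open>Expand the squared distance of \<open>a\<close> and \<open>b\<close>, which is positive.\<close>

lemma dotprod_less:
  assumes "dotprod b b \<le> dotprod a a" "b \<noteq> a"
  shows "dotprod a b < dotprod a a"
proof -
  obtain j where "Poly_Mapping.lookup b j \<noteq> Poly_Mapping.lookup a j" using assms(2) by (meson poly_mapping_eqI)
  then have "0 < (\<Sum>j\<in>UNIV. (int (Poly_Mapping.lookup a j) - int (Poly_Mapping.lookup b j))\<^sup>2)"
    by (intro sum_pos2[of _ j]) auto
  also have "\<dots> = int (dotprod a a) + int (dotprod b b) - 2 * int (dotprod a b)"
    by (simp add: dotprod_def power2_eq_square algebra_simps sum.distrib sum_subtractf sum_distrib_left)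
  finally show ?thesis using assms(1) by linarith
qed

text \<open>The vector \<open>c\<close> is \<open>m\<close> times \<open>a\<close>. The last conjunct, which says that the dot product with \<open>a\<close> singles
  out \<open>c\<close> among the exponents avoiding \<open>A\<close>, is what carries the induction: it excludes any other way
  to reach \<open>a + c\<close> in the next multiplication by \<open>f\<close>.\<close>

lemma exposed_exponent_power:
  fixes f :: "('n::finite, 'k::field) mpoly"
  assumes far: "\<And>b. b \<in> Poly_Mapping.keys f \<Longrightarrow> degree_in A b = 0 \<Longrightarrow> dotprod b b \<le> dotprod a a"
    and a0: "degree_in A a = 0"
  shows "\<exists>c. degree_in A c = 0 \<and> dotprod a c = m * dotprod a a
     \<and> Poly_Mapping.lookup (f ^ m) c = Poly_Mapping.lookup f a ^ m
     \<and> (\<forall>b\<in>Poly_Mapping.keys (f ^ m). degree_in A b = 0 \<longrightarrow> b \<noteq> c \<longrightarrow> dotprod a b < dotprod a c)"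
proof (induction m)
  case 0
  then show ?case by (intro exI[of _ 0]) (auto simp: dotprod_def)
next
  case (Suc m)
  then obtain c where c: "degree_in A c = 0" "dotprod a c = m * dotprod a a"
    "Poly_Mapping.lookup (f ^ m) c = Poly_Mapping.lookup f a ^ m"
    "\<And>b. b \<in> Poly_Mapping.keys (f ^ m) \<Longrightarrow> degree_in A b = 0 \<Longrightarrow> b \<noteq> c \<Longrightarrow> dotprod a b < dotprod a c" by blast
  have key: "dotprod a (b + b') < dotprod a (a + c) \<or> b = a \<and> b' = c"
    if "b \<in> Poly_Mapping.keys f" "b' \<in> Poly_Mapping.keys (f ^ m)" "degree_in A (b + b') = 0" for b b'
  proof -
    have w: "degree_in A b = 0" "degree_in A b' = 0" using that by (auto simp: degree_in_add)
    have "dotprod a b < dotprod a a \<or> b = a" using dotprod_less far that w by blast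
    moreover have "dotprod a b' < dotprod a c \<or> b' = c" using c(4) that w by blast
    ultimately show ?thesis by (auto simp: dotprod_add)
  qed
  have "Poly_Mapping.lookup (f ^ Suc m) (a + c) = Poly_Mapping.lookup f a ^ Suc m"
    unfolding power_Suc c(3)[symmetric]
  proof (rule lookup_mult_unique)
    fix b b' assume bb: "b \<in> Poly_Mapping.keys f" "b' \<in> Poly_Mapping.keys (f ^ m)" "b + b' = a + c"
    then show "b = a \<and> b' = c" using key[OF bb(1,2)] a0 c(1) by (simp add: degree_in_add)
  qed
  moreover have "dotprod a b < dotprod a (a + c)"
    if b: "b \<in> Poly_Mapping.keys (f ^ Suc m)" "degree_in A b = 0" "b \<noteq> a + c" for b
  proof -
    obtain b1 b2 where "b1 \<in> Poly_Mapping.keys f" "b2 \<in> Poly_Mapping.keys (f ^ m)" "b = b1 + b2"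
      using b(1) keys_mult[of f "f ^ m"] by auto
    then show ?thesis using key b by blast
  qed
  ultimately show ?case using a0 c by (intro exI[of _ "a + c"]) (auto simp: degree_in_add dotprod_add)
qed

lemma degree_in_pos_of_power:
  fixes f :: "('n::finite, 'k::field) mpoly"
  assumes pow: "\<And>b. b \<in> Poly_Mapping.keys (f ^ m) \<Longrightarrow> 1 \<le> degree_in A b" and a: "a \<in> Poly_Mapping.keys f"
  shows "1 \<le> degree_in A a"
proof (rule ccontr)
  assume "\<not> 1 \<le> degree_in A a"
  define S where "S = {b \<in> Poly_Mapping.keys f. degree_in A b = 0}"
  have "finite S" "S \<noteq> {}" using a \<open>\<not> 1 \<le> degree_in A a\<close> by (auto simp: S_def)
  then have "Max ((\<lambda>b. dotprod b b) ` S) \<in> (\<lambda>b. dotprod b b) ` S"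
    by (intro Max_in) auto
  then obtain v where v: "v \<in> S" "dotprod v v = Max ((\<lambda>b. dotprod b b) ` S)" by auto
  then have "\<forall>b\<in>S. dotprod b b \<le> dotprod v v" using \<open>finite S\<close> by auto
  with v(1) obtain c where c: "degree_in A c = 0" "Poly_Mapping.lookup (f ^ m) c = Poly_Mapping.lookup f v ^ m"
    using exposed_exponent_power[of f A v m] unfolding S_def by blast
  then have "c \<in> Poly_Mapping.keys (f ^ m)" using v(1) by (simp add: in_keys_iff S_def)
  with pow c(1) show False by fastforce
qed

section \<open>Ideals generated by powers of variables\<close>

definition power_exponents :: "'n set \<Rightarrow> ('n \<Rightarrow> nat) \<Rightarrow> ('n \<Rightarrow>\<^sub>0 nat) set" where
  "power_exponents A d = {a. \<exists>j\<in>A. d j \<le> Poly_Mapping.lookup a j}"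

text \<open>Membership in an ideal generated by monomials is decided term by term.\<close>

lemma pure_power_ideal_eq:
  "ideal_gen ((\<lambda>i. var i ^ d i) ` A) = {f :: ('n, 'k::field) mpoly. Poly_Mapping.keys f \<subseteq> power_exponents A d}"
    (is "?I = ?M")
proof
  have "is_ideal ?M"
    unfolding is_ideal_iff
  proof (intro conjI ballI allI)
    show "x + y \<in> ?M" if "x \<in> ?M" "y \<in> ?M" for x y using that keys_add[of x y] by blast
    show "c * x \<in> ?M" if "x \<in> ?M" for c x
    proof -
      have "b + a \<in> power_exponents A d" if "a \<in> power_exponents A d" for a b
        using that by (force simp: power_exponents_def lookup_add)
      then show ?thesis using that keys_mult[of c x] by blast
    qed
  qed simp
  moreover have "var i ^ d i \<in> ?M" if "i \<in> A" for i
    using that by (auto simp: var_power power_exponents_def intro!: bexI[of _ i])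
  ultimately show "?I \<subseteq> ?M" by (auto simp: ideal_gen_subset_iff)
  show "?M \<subseteq> ?I"
  proof
    fix f assume f: "f \<in> ?M"
    have "(\<Sum>a\<in>Poly_Mapping.keys f. Poly_Mapping.single a (Poly_Mapping.lookup f a)) \<in> ?I"
    proof (rule ideal_sum[OF is_ideal_gen])
      fix a assume "a \<in> Poly_Mapping.keys f"
      then obtain j where j: "j \<in> A" "d j \<le> Poly_Mapping.lookup a j" using f by (auto simp: power_exponents_def)
      then have "(a - Poly_Mapping.single j (d j)) + Poly_Mapping.single j (d j) = a"
        by (intro poly_mapping_eqI) (auto simp: lookup_add lookup_minus lookup_single when_def)
      then have "Poly_Mapping.single a (Poly_Mapping.lookup f a) =
          Poly_Mapping.single (a - Poly_Mapping.single j (d j)) (Poly_Mapping.lookup f a) * var j ^ d j"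
        by (simp add: var_power mult_single)
      moreover have "var j ^ d j \<in> ?I" using j(1) unfolding ideal_gen_def
        by (intro module.span_base[OF module_mult]) auto
      ultimately show "Poly_Mapping.single a (Poly_Mapping.lookup f a) \<in> ?I"
        using ideal_mult_left[OF is_ideal_gen] by metis
    qed
    then show "f \<in> ?I" by (simp flip: poly_mapping_eq_sum_single)
  qed
qed

lemma variables_of_radical:
  assumes "\<forall>i\<in>A. 1 \<le> d i"
  shows "var j \<in> radical {f :: ('n, 'k::field) mpoly. Poly_Mapping.keys f \<subseteq> power_exponents A d} \<longleftrightarrow> j \<in> A"
proof
  assume "var j \<in> radical {f :: ('n, 'k) mpoly. Poly_Mapping.keys f \<subseteq> power_exponents A d}"
  then obtain m where "Poly_Mapping.single j m \<in> power_exponents A d"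
    unfolding radical_def by (auto simp: var_power)
  then obtain l where "l \<in> A" "d l \<le> Poly_Mapping.lookup (Poly_Mapping.single j m) l"
    unfolding power_exponents_def by blast
  with assms show "j \<in> A" by (cases "l = j") (auto simp: lookup_single)
next
  assume "j \<in> A"
  with assms show "var j \<in> radical {f :: ('n, 'k) mpoly. Poly_Mapping.keys f \<subseteq> power_exponents A d}"
    unfolding radical_def by (auto simp: var_power power_exponents_def intro!: exI[of _ "d j"] bexI[of _ j])
qed

text \<open>Each of \<open>N\<close> factors from the radical contributes at least 1 to the degree in \<open>A\<close> of every term of
  their product, while a term outside \<open>I\<close> has degree at most the sum of the \<open>d j - 1\<close>.\<close>

lemma ideal_power_radical_subset:
  fixes A :: "'n::finite set"
  assumes d: "\<forall>i\<in>A. 1 \<le> d i" and N: "(\<Sum>j\<in>A. d j - 1) < N"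
  defines "I \<equiv> {f :: ('n, 'k::field) mpoly. Poly_Mapping.keys f \<subseteq> power_exponents A d}"
  assumes I: "is_ideal I"
  shows "ideal_power (radical I) N \<subseteq> I"
  unfolding ideal_power_def ideal_prod_subset_iff[OF I]
proof (intro allI impI)
  fix f :: "nat \<Rightarrow> ('n, 'k) mpoly" assume f: "\<forall>i\<in>{1..N}. f i \<in> radical I"
  have pos: "1 \<le> degree_in A a" if i: "i \<in> {1..N}" and a: "a \<in> Poly_Mapping.keys (f i)" for i a
  proof -
    obtain m where "f i ^ m \<in> I" using f i unfolding radical_def by blast
    then have "\<exists>j\<in>A. d j \<le> Poly_Mapping.lookup b j" if "b \<in> Poly_Mapping.keys (f i ^ m)" for b
      using that unfolding I_def power_exponents_def by blast
    then have "1 \<le> degree_in A b" if "b \<in> Poly_Mapping.keys (f i ^ m)" for b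
      using that d unfolding degree_in_ge_iff_1 by (meson order_trans)
    then show ?thesis using degree_in_pos_of_power a by blast
  qed
  have "a \<in> power_exponents A d" if a: "a \<in> Poly_Mapping.keys (\<Prod>i\<in>{1..N}. f i)" for a
  proof (rule ccontr)
    assume "a \<notin> power_exponents A d"
    then have "Poly_Mapping.lookup a j < d j" if "j \<in> A" for j
      using that by (auto simp: power_exponents_def not_le)
    then have "degree_in A a \<le> (\<Sum>j\<in>A. d j - 1)"
      unfolding degree_in_def by (intro sum_mono) fastforce
    moreover have "N \<le> degree_in A a" using card_le_degree_in_prod[of "{1..N}" f A a] pos a by simp
    ultimately show False using N by simp
  qed
  then show "(\<Prod>i\<in>{1..N}. f i) \<in> I" unfolding I_def by blast
qed

lemma exponent_as_sum_of_variables: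
  fixes a :: "'n::finite \<Rightarrow>\<^sub>0 nat"
  assumes "degree_in UNIV a = D"
  shows "\<exists>v. a = (\<Sum>i\<in>{1..D}. Poly_Mapping.single (v i) 1)"
  using assms
proof (induction D arbitrary: a)
  case 0
  then have "a = 0" by (intro poly_mapping_eqI) (simp add: degree_in_def)
  then show ?case by simp
next
  case (Suc D)
  then obtain j where j: "1 \<le> Poly_Mapping.lookup a j" using degree_in_ge_iff_1[of UNIV a] by auto
  define b where "b = a - Poly_Mapping.single j 1"
  have a: "a = b + Poly_Mapping.single j 1"
    using j by (intro poly_mapping_eqI) (auto simp: b_def lookup_add lookup_minus lookup_single when_def)
  have "degree_in UNIV (Poly_Mapping.single j 1) = 1"
    by (simp add: degree_in_def lookup_single when_def)
  then have "degree_in UNIV b = D" using Suc.prems by (simp add: a degree_in_add)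
  then obtain v where v: "b = (\<Sum>i\<in>{1..D}. Poly_Mapping.single (v i) 1)" using Suc.IH by blast
  have "b = (\<Sum>i\<in>{1..D}. Poly_Mapping.single ((v(Suc D := j)) i) 1)"
    unfolding v by (intro sum.cong) auto
  then show ?case using a by (intro exI[of _ "v(Suc D := j)"]) (simp del: fun_upd_apply, simp)
qed

lemma prod_var:
  assumes "finite S"
  shows "(\<Prod>i\<in>S. var (v i)) = Poly_Mapping.single (\<Sum>i\<in>S. Poly_Mapping.single (v i) 1) 1"
  using assms by induction (auto simp: var_def mult_single)

text \<open>The witness against absorption consists of the variables whose product is \<open>m\<close>, listed with
  multiplicity, and the sum \<open>L\<close> of the variables in \<open>A\<close>. One more variable in place of \<open>L\<close> would not do: for
  \<open>Q = (x\<^sup>2, y\<^sup>2)\<close> and \<open>m = xy\<close>, the product \<open>x x y\<close> is in \<open>Q\<close>, but so is \<open>x x\<close>, whereas \<open>x (x + y)\<close> still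
  has the term \<open>xy\<close>.\<close>

lemma socle_monomial_not_absorbing:
  fixes Q :: "('n::finite, 'k::field) mpoly set"
  assumes Q: "is_ideal Q"
    and supp: "\<And>j. Poly_Mapping.lookup m j \<noteq> 0 \<Longrightarrow> j \<in> A"
    and m: "\<And>f. f \<in> Q \<Longrightarrow> m \<notin> Poly_Mapping.keys f"
    and socle: "\<And>j. j \<in> A \<Longrightarrow> var j * Poly_Mapping.single m 1 \<in> Q"
    and N: "N \<le> degree_in UNIV m"
  shows "\<not> absorbing N Q"
proof
  define D where "D = degree_in UNIV m"
  assume "absorbing N Q"
  then have abs: "absorbing D Q" using absorbing_mono[OF Q] N unfolding D_def by blast
  obtain v where v: "m = (\<Sum>i\<in>{1..D}. Poly_Mapping.single (v i) 1)"
    using exponent_as_sum_of_variables D_def by metis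
  define L :: "('n, 'k) mpoly" where "L = (\<Sum>j\<in>A. var j)"
  \<comment> \<open>The variables have the indices 1 to \<open>D\<close>, the linear form has the index \<open>D + 1\<close>.\<close>
  define f where "f i = (if i = D+1 then L else var (v i))" for i
  have ins: "{1..D+1} = insert (D+1) {1..D}" by auto
  have f_var: "(\<Prod>i\<in>B. f i) = Poly_Mapping.single (\<Sum>i\<in>B. Poly_Mapping.single (v i) 1) 1"
    if "B \<subseteq> {1..D}" for B
  proof -
    have "(\<Prod>i\<in>B. f i) = (\<Prod>i\<in>B. var (v i))"
      using that by (intro prod.cong) (auto simp: f_def)
    then show ?thesis using that finite_subset[of B "{1..D}"] by (simp add: prod_var)
  qed
  have "(\<Prod>i\<in>{1..D+1}. f i) = L * Poly_Mapping.single m 1"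
    unfolding ins using f_var[of "{1..D}"] by (simp add: v f_def)
  also have "\<dots> \<in> Q" unfolding L_def sum_distrib_right by (intro ideal_sum[OF Q] socle)
  finally obtain j where j: "j \<in> {1..D+1}" and fj: "(\<Prod>i\<in>{1..D+1} - {j}. f i) \<in> Q"
    using abs unfolding absorbing_def by blast
  have "m \<in> Poly_Mapping.keys (\<Prod>i\<in>{1..D+1} - {j}. f i)"
  proof (cases "j = D+1")
    case True
    then have "{1..D+1} - {j} = {1..D}" by auto
    then show ?thesis using f_var[of "{1..D}"] by (simp add: v)
  next
    case False
    define b where "b = (\<Sum>i\<in>{1..D} - {j}. Poly_Mapping.single (v i) (1::nat))"
    have jD: "j \<in> {1..D}" using False j by auto
    have single_inj: "Poly_Mapping.single l (1::nat) = Poly_Mapping.single l' 1 \<longleftrightarrow> l = l'"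
      for l l' :: 'n
      by (metis lookup_single_eq lookup_single_not_eq zero_neq_one)
    \<comment> \<open>The term of \<open>L\<close> equal to the omitted variable restores \<open>m\<close>; the other terms give other
      monomials.\<close>
    have mb: "m = Poly_Mapping.single (v j) 1 + b"
      unfolding v b_def using jD by (intro sum.remove) auto
    have vA: "v j \<in> A" by (rule supp) (simp add: mb lookup_add)
    have "{1..D+1} - {j} = insert (D+1) ({1..D} - {j})" using False j by auto
    then have "(\<Prod>i\<in>{1..D+1} - {j}. f i) = L * Poly_Mapping.single b 1"
      using f_var[of "{1..D} - {j}"] by (simp add: f_def b_def)
    also have "\<dots> = (\<Sum>l\<in>A. Poly_Mapping.single (Poly_Mapping.single l 1 + b) 1)"
      by (simp add: L_def sum_distrib_right var_def mult_single)
    finally have "Poly_Mapping.lookup (\<Prod>i\<in>{1..D+1} - {j}. f i) m = (\<Sum>l\<in>A. if l = v j then 1 else 0)"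
      by (simp add: lookup_sum lookup_single when_def mb single_inj del: One_nat_def)
    then show ?thesis using vA by (simp add: in_keys_iff)
  qed
  with m fj show False by blast
qed

theorem corollary2:
  fixes Q :: "('n::finite, 'k::field) mpoly set"
    and Qs :: "nat \<Rightarrow> ('n, 'k) mpoly set"
    and r :: nat
  assumes "monomial_ideal Q"
    and "primary_ideal Q"
    and "standard_decomposition Q r Qs"
  shows "omega Q = strong_omega Q \<and> strong_omega Q = (MAX i\<in>{1..r}. noether_exponent (Qs i))"
proof -
  let ?R = "{1..r}"
  have Q: "is_ideal Q" and proper: "Q \<noteq> UNIV" using assms(2) unfolding primary_ideal_def by auto
  have pure: "\<forall>i\<in>?R. pure_power_ideal (Qs i)" and int: "Q = (\<Inter>i\<in>?R. Qs i)"
    and irr: "\<And>j. j \<in> ?R \<Longrightarrow> (\<Inter>i\<in>?R - {j}. Qs i) \<noteq> Q"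
    using assms(3) unfolding standard_decomposition_def by auto
  have R: "?R \<noteq> {}" using int proper by auto
  have "\<forall>i\<in>?R. \<exists>A d. (\<forall>j\<in>A. 1 \<le> d j) \<and> Qs i = {f. Poly_Mapping.keys f \<subseteq> power_exponents A d}"
    using pure unfolding pure_power_ideal_def pure_power_ideal_eq by blast
  then obtain A d where d: "\<And>i. i \<in> ?R \<Longrightarrow> \<forall>j\<in>A i. 1 \<le> d i j"
    and Qs: "\<And>i. i \<in> ?R \<Longrightarrow> Qs i = {f. Poly_Mapping.keys f \<subseteq> power_exponents (A i) (d i)}"
    by metis
  have ideal: "is_ideal (Qs i)" if "i \<in> ?R" for i
    using that pure is_ideal_gen unfolding pure_power_ideal_def by metis
  have rad: "radical (Qs i) = radical Q" if i: "i \<in> ?R" for i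
  proof (rule radical_component_of_primary[OF assms(2)])
    show "Q = Qs i \<inter> (\<Inter>l\<in>?R - {i}. Qs l)" using int i by blast
    show "is_ideal (\<Inter>l\<in>?R - {i}. Qs l)" using ideal by (auto simp: is_ideal_iff)
  qed (use i ideal irr in auto)
  have A: "A i = {j. var j \<in> radical Q}" if "i \<in> ?R" for i
    using variables_of_radical[OF d[OF that]] rad[OF that] Qs[OF that] by auto

  have upper: "strong_omega Q \<le> enat N"
    if N: "\<And>i. i \<in> ?R \<Longrightarrow> noether_exponent (Qs i) \<le> enat N" for N
  proof -
    have "N \<noteq> 0"
    proof
      assume "N = 0"
      then have "\<forall>i\<in>?R. Qs i = UNIV" using N by (auto simp: noether_exponent_0_iff simp flip: zero_enat_def)
      then show False using int proper by auto
    qed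
    moreover have "ideal_power (radical Q) N \<subseteq> Qs i" if "i \<in> ?R" for i
      using noether_exponent_le_imp[OF ideal N] rad that by metis
    then have "ideal_power (radical Q) N \<subseteq> Q" by (subst (2) int) blast
    ultimately have "\<exists>M\<le>N. M \<ge> 1 \<and> strongly_absorbing M Q"
      using primary_strongly_absorbing[OF assms(2)] by (intro exI[of _ N]) auto
    then show ?thesis using proper by (simp add: strong_omega_def Inf_enat_image_le_iff)
  qed

  have lower: "noether_exponent (Qs i) \<le> enat N"
    if i: "i \<in> ?R" and N: "1 \<le> N" "absorbing N Q" for i N
  proof (cases "(\<Sum>j\<in>A i. d i j - 1) < N")
    case True
    have "ideal_power (radical (Qs i)) N \<subseteq> Qs i"
      using ideal_power_radical_subset[OF d[OF i] True] ideal[OF i] unfolding Qs[OF i] by blast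
    then show ?thesis using N by (intro noether_exponent_leI)
  next
    case False
    \<comment> \<open>The exponent vector \<open>m\<close> is the largest one supported on \<open>A i\<close> outside \<open>Qs i\<close>. It lies in every
      other component because the exponent \<open>a\<close> below does and is bounded by \<open>m\<close> on \<open>A i\<close>.\<close>
    define m where "m = Abs_poly_mapping (\<lambda>j. if j \<in> A i then d i j - 1 else 0)"
    have lm: "Poly_Mapping.lookup m j = (if j \<in> A i then d i j - 1 else 0)" for j
      unfolding m_def by (subst Abs_poly_mapping_inverse) auto
    have m_i: "m \<notin> power_exponents (A i) (d i)"
      using d[OF i] by (auto simp: power_exponents_def lm)
    obtain u where u: "u \<in> (\<Inter>l\<in>?R - {i}. Qs l)" "u \<notin> Q" using irr[OF i] int by blast
    then have "u \<notin> Qs i" using int by blast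
    then obtain a where a: "a \<in> Poly_Mapping.keys u" "a \<notin> power_exponents (A i) (d i)" using Qs[OF i] by blast
    have m_l: "m \<in> power_exponents (A l) (d l)" if l: "l \<in> ?R" "l \<noteq> i" for l
    proof -
      have "a \<in> power_exponents (A l) (d l)" using u(1) l a(1) Qs[OF l(1)] by blast
      then obtain j where "j \<in> A l" "d l j \<le> Poly_Mapping.lookup a j" by (auto simp: power_exponents_def)
      moreover have "A l = A i" using A l i by auto
      moreover have "Poly_Mapping.lookup a j < d i j" if "j \<in> A i" using a(2) that by (auto simp: power_exponents_def)
      ultimately show ?thesis by (force simp: power_exponents_def lm)
    qed
    have "\<not> absorbing N Q"
    proof (rule socle_monomial_not_absorbing[OF Q])
      show "j \<in> A i" if "Poly_Mapping.lookup m j \<noteq> 0" for j using that by (auto simp: lm split: if_splits)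
      show "m \<notin> Poly_Mapping.keys f" if "f \<in> Q" for f using that m_i int i Qs[OF i] by blast
      show "var j * Poly_Mapping.single m 1 \<in> Q" if j: "j \<in> A i" for j
      proof -
        have "Poly_Mapping.single j 1 + m \<in> power_exponents (A l) (d l)" if l: "l \<in> ?R" for l
        proof (cases "l = i")
          case True
          then show ?thesis using j d[OF i] by (auto simp: power_exponents_def lookup_add lm intro!: bexI[of _ j])
        next
          case False
          then show ?thesis using m_l[OF l] by (force simp: power_exponents_def lookup_add)
        qed
        then show ?thesis unfolding int using Qs by (auto simp: var_def mult_single)
      qed
      have "degree_in UNIV m = (\<Sum>j\<in>A i. d i j - 1)"
        by (simp add: degree_in_def lm sum.If_cases)
      then show "N \<le> degree_in UNIV m" using False by simp
    qed
    with N show ?thesis by blast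
  qed

  define E where "E = (MAX i\<in>?R. noether_exponent (Qs i))"
  have E_ge: "noether_exponent (Qs i) \<le> E" if "i \<in> ?R" for i
    unfolding E_def using that by (intro Max_ge) auto
  have "strong_omega Q \<le> E"
  proof (cases E)
    case (enat N)
    then show ?thesis using upper E_ge by metis
  qed simp
  moreover have "E \<le> omega Q"
    unfolding omega_def E_def using proper R lower by (auto intro!: Inf_greatest)
  moreover have "omega Q \<le> strong_omega Q" by (rule omega_le_strong_omega[OF Q])
  ultimately show ?thesis unfolding E_def by auto
qed

end
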